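(* Let $d\ge2$, $\mathcal{C}>0$, $\beta>0$, and let $X$ be a $p_n$-ERW in direction $\ell\in\mathbb{S}^{d-1}$ on $\mathbb{Z}^d$ with $p_n=\mathcal{C}n^{-\beta}\wedge1$. Then $$\limsup_{n\to\infty}\frac{|\mathcal{R}_n^X|}{n}\le\pi_d\quad\text{almost surely.}$$
   Context: Definition of the $p_n$-ERW in direction $\ell$ on $\mathbb{Z}^d$. Let $d\ge 2$, let $\ell\in\mathbb{S}^{d-1}$ (the unit sphere of $\mathbb{R}^d$), let $\|\cdot\|$ be the Euclidean norm, and let $\{p_n\}_{n\ge1}\subset(0,1]$. Let $\{\xi_i\}_{i\ge1}$ and $\{\gamma_i\}_{i\ge1}$ be sequences of $\mathbb{Z}^d$-valued random vectors on a probability space $(\Omega,\mathcal{F},\mathbb{P})$, adapted to a filtration $\{\mathcal{F}_n\}_{n\ge0}$ (with $\mathcal{F}_0$ containing all null sets), such that: (i) there is a constant $K>0$ with $\sup_{n}\|\xi_n\|\le K$ and $\sup_n\|\gamma_n\|\le K$ on every realization; (ii) there is a constant $\lambda>0$ such that for all $n\ge1$, $\mathbb{E}[\xi_n\mid\mathcal{F}_{n-1}]=0$ and $\mathbb{E}[\gamma_n\cdot\ell\mid\mathcal{F}_{n-1}]\ge\lambda$; (iii) $\{\xi_i\}$ is i.i.d. with zero mean vector and finite covariance matrix, and $\mathbb{P}[\xi_i\cdot\ell'=0]<1$ for all $\ell'\in\mathbb{S}^{d-1}$; (iv) $\{\gamma_i\}$ is i.i.d., and the sequences $\{\xi_i\}$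 and $\{\gamma_i\}$ are independent of each other. Let $\{U_i\}_{i\ge1}$ be i.i.d. uniform on $[0,1]$, independent of $(\{\xi_i\},\{\gamma_i\})$. Set $X_0=0$, $E_0=\emptyset$, and for $n\ge1$ let $E_n=\{\exists k<n:\ X_k=X_n\}$. The process $X=\{X_n\}_{n\ge0}$ is defined by $$X_n=\sum_{i=1}^n\Big(\mathbf{1}_{E_{i-1}}\xi_i+\mathbf{1}_{E_{i-1}^c\cap\{U_i>p_i\}}\xi_i+\mathbf{1}_{E_{i-1}^c\cap\{U_i\le p_i\}}\gamma_i\Big),\quad n\ge1.$$ The range is $\mathcal{R}_n^X=\{X_0,X_1,\dots,X_n\}\subset\mathbb{Z}^d$. The constant $\pi_d$ is the probability that the random walk $Y_n=\sum_{i=1}^n\xi_i$, $Y_0=0$, never returns to the origin. $a\wedge b=\min(a,b)$. *)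

theory Defs
  imports "HOL-Probability.Probability"
begin

text \<open>
  The lattice $\mathbb{Z}^d$ is the type \<open>int ^ 'd\<close> with $d = \mathrm{CARD}('d)$, carrying the
  discrete sigma-algebra. Sequences \<open>\<xi>\<close>, \<open>\<gamma>\<close>, \<open>U\<close>, \<open>p\<close> are indexed by $n \ge 1$; their values
  at index 0 are never used.
\<close>

definition real_vec :: "int ^ 'd \<Rightarrow> real ^ 'd" where
  "real_vec x = (\<chi> j. real_of_int (x $ j))"

text \<open>
  One path of the walk, driven by fixed sequences of steps \<open>x\<close>, \<open>g\<close> and of uniform variables \<open>u\<close>.
  Site \<open>i - 1\<close> of the path is old (the event $E_{i-1}$) if it equals \<open>erw_path p x g u k\<close> for some
  \<open>k < i - 1\<close>. For \<open>n = 0\<close> the sum is empty, so the path starts at 0.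
\<close>

context
  notes sum.cong [fundef_cong]
begin

function erw_path ::
  "(nat \<Rightarrow> real) \<Rightarrow> (nat \<Rightarrow> int ^ 'd) \<Rightarrow> (nat \<Rightarrow> int ^ 'd) \<Rightarrow> (nat \<Rightarrow> real) \<Rightarrow> nat \<Rightarrow> int ^ 'd"
where
  "erw_path p x g u n = (\<Sum>i\<in>{1..n}.
     let old = (\<exists>k\<in>{..<i - 1}. erw_path p x g u k = erw_path p x g u (i - 1)) in
       of_bool old *s x i
     + of_bool (\<not> old \<and> u i > p i) *s x i
     + of_bool (\<not> old \<and> u i \<le> p i) *s g i)"
  by pat_completeness auto
termination by (relation "Wellfounded.measure (\<lambda>(p, x, g, u, n). n)") auto

end

declare erw_path.simps [simp del]

definition erw ::
  "(nat \<Rightarrow> real) \<Rightarrow> (nat \<Rightarrow> 'a \<Rightarrow> int ^ 'd) \<Rightarrow> (nat \<Rightarrow> 'a \<Rightarrow> int ^ 'd) \<Rightarrow> (nat \<Rightarrow> 'a \<Rightarrow> real)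
    \<Rightarrow> nat \<Rightarrow> 'a \<Rightarrow> int ^ 'd"
where
  "erw p \<xi> \<gamma> U n \<omega> = erw_path p (\<lambda>i. \<xi> i \<omega>) (\<lambda>i. \<gamma> i \<omega>) (\<lambda>i. U i \<omega>) n"

definition walk_range :: "(nat \<Rightarrow> 'a \<Rightarrow> 'b) \<Rightarrow> nat \<Rightarrow> 'a \<Rightarrow> 'b set" where
  "walk_range X n \<omega> = (\<lambda>k. X k \<omega>) ` {0..n}"

definition random_walk :: "(nat \<Rightarrow> 'a \<Rightarrow> int ^ 'd) \<Rightarrow> nat \<Rightarrow> 'a \<Rightarrow> int ^ 'd" where
  "random_walk \<xi> n \<omega> = (\<Sum>i\<in>{1..n}. \<xi> i \<omega>)"

definition escape_prob :: "'a measure \<Rightarrow> (nat \<Rightarrow> 'a \<Rightarrow> int ^ 'd) \<Rightarrow> real" where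
  "escape_prob M \<xi> = measure M {\<omega> \<in> space M. \<forall>n\<ge>1. random_walk \<xi> n \<omega> \<noteq> 0}"

definition (in prob_space) iid_seq :: "'b measure \<Rightarrow> (nat \<Rightarrow> 'a \<Rightarrow> 'b) \<Rightarrow> bool" where
  "iid_seq N X \<longleftrightarrow>
     indep_vars (\<lambda>_. N) X {1..} \<and> (\<forall>i\<ge>1. distr M N (X i) = distr M N (X 1))"

text \<open>A whole sequence as a single random element of the countable product space.\<close>

abbreviation seq_space :: "'b measure \<Rightarrow> (nat \<Rightarrow> 'b) measure" where
  "seq_space N \<equiv> PiM {1..} (\<lambda>_. N)"

definition seq_rv :: "(nat \<Rightarrow> 'a \<Rightarrow> 'b) \<Rightarrow> 'a \<Rightarrow> nat \<Rightarrow> 'b" where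
  "seq_rv X \<omega> = (\<lambda>i\<in>{1..}. X i \<omega>)"

text \<open>
  The data of a $p_n$-ERW in direction \<open>l\<close>; the walk itself is \<open>erw p \<xi> \<gamma> U\<close>.
  Conditional expectations of vectors are taken coordinatewise. Independence of \<open>U\<close> from the pair
  \<open>(\<xi>, \<gamma>)\<close> is stated for the generated sigma-algebras because \<open>indep_var\<close> requires both random
  variables to have the same type.
\<close>

locale excited_random_walk = prob_space M + filtration "space M" F
  for M :: "'a measure" and F :: "nat \<Rightarrow> 'a measure" +
  fixes l :: "real ^ 'd"
    and p :: "nat \<Rightarrow> real"
    and \<xi> \<gamma> :: "nat \<Rightarrow> 'a \<Rightarrow> int ^ 'd"
    and U :: "nat \<Rightarrow> 'a \<Rightarrow> real"
  assumes direction: "norm l = 1"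
    and p_range: "\<And>n. n \<ge> 1 \<Longrightarrow> p n \<in> {0<..1}"
    and subalg: "\<And>n. subalgebra M (F n)"
    and null_sets_F0: "null_sets M \<subseteq> sets (F 0)"
    and adapted_xi: "\<And>n. n \<ge> 1 \<Longrightarrow> \<xi> n \<in> F n \<rightarrow>\<^sub>M count_space UNIV"
    and adapted_gamma: "\<And>n. n \<ge> 1 \<Longrightarrow> \<gamma> n \<in> F n \<rightarrow>\<^sub>M count_space UNIV"
    and bounded_steps: "\<exists>K>0. \<forall>\<omega>\<in>space M. \<forall>n\<ge>1.
          norm (real_vec (\<xi> n \<omega>)) \<le> K \<and> norm (real_vec (\<gamma> n \<omega>)) \<le> K"
    and xi_martingale: "\<And>n j. n \<ge> 1 \<Longrightarrow>
          AE \<omega> in M. real_cond_exp M (F (n - 1)) (\<lambda>\<omega>. real_vec (\<xi> n \<omega>) $ j) \<omega> = 0"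
    and gamma_drift: "\<exists>c>0. \<forall>n\<ge>1.
          AE \<omega> in M. real_cond_exp M (F (n - 1)) (\<lambda>\<omega>. real_vec (\<gamma> n \<omega>) \<bullet> l) \<omega> \<ge> c"
    and xi_iid: "iid_seq (count_space UNIV) \<xi>"
    and xi_mean: "\<And>n. n \<ge> 1 \<Longrightarrow>
          integrable M (\<lambda>\<omega>. real_vec (\<xi> n \<omega>)) \<and> expectation (\<lambda>\<omega>. real_vec (\<xi> n \<omega>)) = 0"
    and xi_covariance: "\<And>n j k. n \<ge> 1 \<Longrightarrow>
          integrable M (\<lambda>\<omega>. real_vec (\<xi> n \<omega>) $ j * real_vec (\<xi> n \<omega>) $ k)"
    and xi_nondegenerate: "\<And>n v. n \<ge> 1 \<Longrightarrow> norm v = 1 \<Longrightarrow>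
          prob {\<omega> \<in> space M. real_vec (\<xi> n \<omega>) \<bullet> v = 0} < 1"
    and gamma_iid: "iid_seq (count_space UNIV) \<gamma>"
    and xi_gamma_indep: "indep_var (seq_space (count_space UNIV)) (seq_rv \<xi>)
          (seq_space (count_space UNIV)) (seq_rv \<gamma>)"
    and U_iid: "iid_seq borel U"
    and U_uniform: "\<And>n. n \<ge> 1 \<Longrightarrow> distr M lborel (U n) = uniform_measure lborel {0..1}"
    and U_indep: "indep_set
          (sets (vimage_algebra (space M) (seq_rv U) (seq_space borel)))
          (sets (vimage_algebra (space M) (\<lambda>\<omega>. (seq_rv \<xi> \<omega>, seq_rv \<gamma> \<omega>))
            (seq_space (count_space UNIV) \<Otimes>\<^sub>M seq_space (count_space UNIV))))"

end

theory Submission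
  imports Defs "HOL-Real_Asymp.Real_Asymp"
begin

text \<open>
  Every site of the range is counted at the time of its last visit, and after that time the walk
  does not come back. Fix a window length \<open>m\<close>. Apart from the last \<open>m\<close> times, a last visit at time
  \<open>k\<close> is followed by \<open>m\<close> steps without return to the current site, so the range has at most \<open>m\<close>
  points more than there are such times \<open>k\<close> (\<open>card_range_le_no_return_times\<close>). Those times are of
  two kinds. Either the threshold event \<open>U i \<le> p i\<close> occurs within the \<open>m\<close> steps; since \<open>p\<close> tends
  to 0, the threshold events, and hence also the times shortly before them, have density 0
  (\<open>vanishing_threshold_density\<close>, \<open>upper_density_le_zero_windows\<close>). Or else the walk moves by the
  increments of \<open>\<xi>\<close> during the whole window, and then no partial sum of
  \<open>\<xi> (k + 1), \<dots>, \<xi> (k + m)\<close> vanishes.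

  The second kind is a property of \<open>\<xi>\<close> alone, where independence is available. Windows
  whose starting times agree modulo \<open>m\<close> are disjoint, hence independent and identically
  distributed, so these times have upper density at most the probability that the random walk
  makes no return to 0 in its first \<open>m\<close> steps (\<open>window_occurrence_density\<close>). The half of the strong
  law of large numbers used here, an almost sure upper bound for the frequency of independent
  events, comes from Hoeffding's inequality and the Borel-Cantelli lemma
  (\<open>indep_vars_occurrence_density\<close>). So the limsup is almost surely at most the probability of
  no return within \<open>m\<close> steps, for every \<open>m \<ge> 1\<close>, and these probabilities decrease to the escape
  probability.
\<close>

section \<open>Upper densities of sets of times\<close>

text \<open>
  The limsup of \<open>card (S \<inter> {..<n}) / n\<close> is at most \<open>c\<close>, written without division and in the reals,
  which makes sums of such bounds plain arithmetic.
\<close>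

definition upper_density_le :: "nat set \<Rightarrow> real \<Rightarrow> bool" where
  "upper_density_le S c \<longleftrightarrow>
     (\<forall>\<epsilon>>0. eventually (\<lambda>n. real (card (S \<inter> {..<n})) \<le> (c + \<epsilon>) * real n) sequentially)"

text \<open>
  A bounded excess is invisible to densities. All perturbations below reduce to this: finitely many
  extra times, translations, and the boundary term in the count of the range.
\<close>

lemma eventually_le_slope_of_bounded_excess:
  assumes S: "upper_density_le S c"
    and x: "\<And>n. x n \<le> card (S \<inter> {..<n}) + b" and "\<epsilon> > 0"
  shows "eventually (\<lambda>n. real (x n) \<le> (c + \<epsilon>) * real n) sequentially"
proof -
  have "eventually (\<lambda>n. real (card (S \<inter> {..<n})) \<le> (c + \<epsilon> / 2) * real n) sequentially"
    using S \<open>\<epsilon> > 0\<close> unfolding upper_density_le_def by simp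
  moreover have "eventually (\<lambda>n. real b \<le> \<epsilon> / 2 * real n) sequentially"
    using \<open>\<epsilon> > 0\<close> by real_asymp
  ultimately show ?thesis
  proof eventually_elim
    case (elim n)
    have "real (x n) \<le> real (card (S \<inter> {..<n})) + real b"
      using x[of n] by linarith
    with elim show ?case by (simp add: algebra_simps)
  qed
qed

lemma upper_density_le_finite_excess:
  assumes S: "upper_density_le S c" and TS: "finite (T - S)"
  shows "upper_density_le T c"
proof -
  have "card (T \<inter> {..<n}) \<le> card (S \<inter> {..<n}) + card (T - S)" for n
  proof -
    have "card (T \<inter> {..<n}) \<le> card ((S \<inter> {..<n}) \<union> (T - S))"
      using TS by (intro card_mono) auto
    also have "\<dots> \<le> card (S \<inter> {..<n}) + card (T - S)"
      by (rule card_Un_le)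
    finally show ?thesis .
  qed
  from eventually_le_slope_of_bounded_excess[OF S this] show ?thesis
    unfolding upper_density_le_def by blast
qed

lemma upper_density_le_mono:
  assumes "upper_density_le S c" and "T \<subseteq> S"
  shows "upper_density_le T c"
proof -
  have "T - S = {}" using assms(2) by blast
  then show ?thesis
    by (intro upper_density_le_finite_excess[OF assms(1)]) (simp only: finite.emptyI)
qed

lemma upper_density_le_shift:
  assumes S: "upper_density_le S c"
  shows "upper_density_le {k. k + j \<in> S} c"
proof -
  have "card ({k. k + j \<in> S} \<inter> {..<n}) \<le> card (S \<inter> {..<n}) + j" for n
  proof -
    have "card ({k. k + j \<in> S} \<inter> {..<n}) = card ((\<lambda>k. k + j) ` ({k. k + j \<in> S} \<inter> {..<n}))"
      by (simp add: card_image)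
    also have "\<dots> \<le> card ((S \<inter> {..<n}) \<union> {n..<n + j})"
      by (intro card_mono) auto
    also have "\<dots> \<le> card (S \<inter> {..<n}) + j"
      using card_Un_le[of "S \<inter> {..<n}" "{n..<n + j}"] by simp
    finally show ?thesis .
  qed
  from eventually_le_slope_of_bounded_excess[OF S this] show ?thesis
    unfolding upper_density_le_def by blast
qed

lemma upper_density_le_Un:
  assumes "upper_density_le S c" and "upper_density_le T d"
  shows "upper_density_le (S \<union> T) (c + d)"
  unfolding upper_density_le_def
proof (intro allI impI)
  fix \<epsilon> :: real assume "\<epsilon> > 0"
  have "eventually (\<lambda>n. real (card (S \<inter> {..<n})) \<le> (c + \<epsilon> / 2) * real n) sequentially"
       "eventually (\<lambda>n. real (card (T \<inter> {..<n})) \<le> (d + \<epsilon> / 2) * real n) sequentially"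
    using assms \<open>\<epsilon> > 0\<close> unfolding upper_density_le_def by simp_all
  then show "eventually (\<lambda>n. real (card ((S \<union> T) \<inter> {..<n})) \<le> (c + d + \<epsilon>) * real n) sequentially"
  proof eventually_elim
    case (elim n)
    have "card ((S \<union> T) \<inter> {..<n}) \<le> card (S \<inter> {..<n}) + card (T \<inter> {..<n})"
      by (simp add: Int_Un_distrib2 card_Un_le)
    with elim show ?case by (simp add: algebra_simps)
  qed
qed

lemma upper_density_le_zero_windows:
  assumes S: "upper_density_le S 0"
  shows "upper_density_le {k. \<exists>j<m. k + j \<in> S} 0"
proof (induction m)
  case 0
  then show ?case by (simp add: upper_density_le_def)
next
  case (Suc m)
  have "{k. \<exists>j<Suc m. k + j \<in> S} = {k. \<exists>j<m. k + j \<in> S} \<union> {k. k + m \<in> S}"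
    by (auto simp: less_Suc_eq)
  then show ?case
    using upper_density_le_Un[OF Suc upper_density_le_shift[OF S, of m]] by simp
qed

text \<open>
  Among the first \<open>n\<close> times there are at most \<open>n div m + 1\<close> in each residue class modulo \<open>m\<close>, so a
  common bound for the relative densities in the \<open>m\<close> classes bounds the density of the whole set.
  This is how \<open>m\<close>-dependent events are reduced to independent ones.
\<close>

lemma upper_density_le_residue_classes:
  assumes "m \<ge> 1" and "c \<ge> 0"
    and classes: "\<And>r. r < m \<Longrightarrow> upper_density_le {q. r + q * m \<in> S} c"
  shows "upper_density_le S c"
  unfolding upper_density_le_def
proof (intro allI impI)
  fix \<epsilon> :: real assume "\<epsilon> > 0"
  let ?C = "\<lambda>r. {q. r + q * m \<in> S}"
  let ?N = "\<lambda>n. n div m + 1"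
  have "eventually (\<lambda>N. \<forall>r\<in>{..<m}. real (card (?C r \<inter> {..<N})) \<le> (c + \<epsilon> / 2) * real N) sequentially"
    using classes \<open>\<epsilon> > 0\<close> unfolding upper_density_le_def
    by (intro eventually_ball_finite) auto
  moreover have "filterlim ?N at_top sequentially"
  proof (rule filterlim_at_top_mono[where f = "\<lambda>n. n div m"])
    show "filterlim (\<lambda>n. n div m) at_top sequentially"
      using assms(1) by (intro filterlim_at_top_div_const_nat) auto
  qed auto
  ultimately have
    "eventually (\<lambda>n. \<forall>r\<in>{..<m}. real (card (?C r \<inter> {..<?N n})) \<le> (c + \<epsilon> / 2) * real (?N n)) sequentially"
    by (rule eventually_compose_filterlim)
  moreover have "eventually (\<lambda>n. (c + \<epsilon> / 2) * real m \<le> \<epsilon> / 2 * real n) sequentially"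
    using \<open>\<epsilon> > 0\<close> by real_asymp
  ultimately show "eventually (\<lambda>n. real (card (S \<inter> {..<n})) \<le> (c + \<epsilon>) * real n) sequentially"
  proof eventually_elim
    case (elim n)
    have sub: "S \<inter> {..<n} \<subseteq> (\<Union>r<m. (\<lambda>q. r + q * m) ` (?C r \<inter> {..<?N n}))"
    proof
      fix k assume k: "k \<in> S \<inter> {..<n}"
      have "k = k mod m + (k div m) * m" by simp
      moreover have "k div m < ?N n"
        using k div_le_mono[of k n m] by (auto simp: less_Suc_eq_le)
      ultimately show "k \<in> (\<Union>r<m. (\<lambda>q. r + q * m) ` (?C r \<inter> {..<?N n}))"
        using k assms(1)
        by (intro UN_I[of "k mod m"] image_eqI[of _ _ "k div m"]) auto
    qed
    have "card (S \<inter> {..<n}) \<le> (\<Sum>r<m. card ((\<lambda>q. r + q * m) ` (?C r \<inter> {..<?N n})))"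
      by (rule order.trans[OF card_mono[OF _ sub] card_UN_le]) auto
    also have "\<dots> \<le> (\<Sum>r<m. card (?C r \<inter> {..<?N n}))"
      by (intro sum_mono card_image_le) auto
    finally have "real (card (S \<inter> {..<n})) \<le> (\<Sum>r<m. real (card (?C r \<inter> {..<?N n})))"
      by (metis of_nat_mono of_nat_sum)
    also have "\<dots> \<le> (\<Sum>r<m. (c + \<epsilon> / 2) * real (?N n))"
      using elim(1) by (intro sum_mono) auto
    also have "\<dots> = (c + \<epsilon> / 2) * real (m * ?N n)"
      by (simp add: algebra_simps)
    also have "\<dots> \<le> (c + \<epsilon> / 2) * (real n + real m)"
    proof (intro mult_left_mono)
      have "m * ?N n \<le> n + m" by simp
      then show "real (m * ?N n) \<le> real n + real m" by linarith
    qed (use assms(2) \<open>\<epsilon> > 0\<close> in auto)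
    also have "\<dots> \<le> (c + \<epsilon>) * real n"
      using elim(2) by (simp add: field_simps)
    finally show ?case .
  qed
qed

section \<open>Counting the range of a path by times without early return\<close>

text \<open>
  A value of the path is charged to the last time \<open>k \<le> n\<close> at which it is taken. If \<open>k + m \<le> n\<close>, the
  window after \<open>k\<close> contains no return; otherwise \<open>k\<close> is one of the last \<open>m\<close> times.
\<close>

lemma card_range_le_no_return_times:
  fixes f :: "nat \<Rightarrow> 'b"
  assumes "m \<ge> 1"
  shows "card (f ` {0..n}) \<le> card ({k. \<forall>j\<in>{1..m}. f (k + j) \<noteq> f k} \<inter> {..<n}) + m"
proof -
  let ?A = "{k. \<forall>j\<in>{1..m}. f (k + j) \<noteq> f k} \<inter> {..<n}"
  have "f ` {0..n} \<subseteq> f ` (?A \<union> {n + 1 - m..n})"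
  proof
    fix v assume "v \<in> f ` {0..n}"
    then have ne: "{k\<in>{0..n}. f k = v} \<noteq> {}" by auto
    define k where "k = Max {k\<in>{0..n}. f k = v}"
    have k: "k \<le> n" "f k = v"
      using Max_in[OF _ ne] unfolding k_def by auto
    have later: "f i \<noteq> v" if "k < i" "i \<le> n" for i
    proof
      assume "f i = v"
      then have "i \<le> k"
        unfolding k_def using that(2) by (intro Max_ge) auto
      then show False using that(1) by simp
    qed
    have "k \<in> ?A \<union> {n + 1 - m..n}"
    proof (cases "k + m \<le> n")
      case True
      then show ?thesis using assms k later by auto
    next
      case False
      then show ?thesis using k by auto
    qed
    then show "v \<in> f ` (?A \<union> {n + 1 - m..n})" using k by blast
  qed
  then have "card (f ` {0..n}) \<le> card (?A \<union> {n + 1 - m..n})"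
    by (intro surj_card_le) auto
  also have "\<dots> \<le> card ?A + card {n + 1 - m..n}" by (rule card_Un_le)
  also have "\<dots> \<le> card ?A + m" by simp
  finally show ?thesis .
qed

lemma erw_path_Suc_unexcited:
  assumes "u (Suc n) > p (Suc n)"
  shows "erw_path p x g u (Suc n) = erw_path p x g u n + x (Suc n)"
proof -
  let ?step = "\<lambda>i. let old = (\<exists>k\<in>{..<i - 1}. erw_path p x g u k = erw_path p x g u (i - 1)) in
       of_bool old *s x i
     + of_bool (\<not> old \<and> u i > p i) *s x i
     + of_bool (\<not> old \<and> u i \<le> p i) *s g i"
  have "erw_path p x g u (Suc n) = (\<Sum>i\<in>{1..n}. ?step i) + ?step (Suc n)"
    using erw_path.simps[of p x g u "Suc n"] by (simp only: sum.cl_ivl_Suc) simp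
  also have "(\<Sum>i\<in>{1..n}. ?step i) = erw_path p x g u n"
    by (simp only: erw_path.simps[of p x g u n])
  also have "?step (Suc n) = x (Suc n)"
    using assms by (simp add: Let_def)
  finally show ?thesis .
qed

lemma erw_path_unexcited_window:
  assumes "\<And>i. i < j \<Longrightarrow> u (Suc (k + i)) > p (Suc (k + i))"
  shows "erw_path p x g u (k + j) = erw_path p x g u k + (\<Sum>i\<in>{1..j}. x (k + i))"
  using assms by (induction j) (simp_all add: erw_path_Suc_unexcited algebra_simps)

text \<open>
  Blocks of \<open>m\<close> increments with no vanishing partial sum. They are indexed by \<open>{1..m}\<close> and extensional
  because they are to be points of the finite product space over \<open>{1..m}\<close>, where every window,
  whatever its starting time, has the same law.
\<close>

definition no_return_windows :: "nat \<Rightarrow> (nat \<Rightarrow> 'b :: comm_monoid_add) set" where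
  "no_return_windows m = {w \<in> extensional {1..m}. \<forall>j\<in>{1..m}. (\<Sum>i\<in>{1..j}. w i) \<noteq> 0}"

definition window :: "nat \<Rightarrow> nat \<Rightarrow> (nat \<Rightarrow> 'b) \<Rightarrow> nat \<Rightarrow> 'b" where
  "window m k x = (\<lambda>i\<in>{1..m}. x (k + i))"

lemma window_in_no_return_windows_iff:
  "window m k x \<in> no_return_windows m \<longleftrightarrow> (\<forall>j\<in>{1..m}. (\<Sum>i\<in>{1..j}. x (k + i)) \<noteq> 0)"
proof -
  have "(\<Sum>i\<in>{1..j}. window m k x i) = (\<Sum>i\<in>{1..j}. x (k + i))" if "j \<in> {1..m}" for j
    using that by (intro sum.cong) (auto simp: window_def)
  then show ?thesis
    by (simp add: no_return_windows_def) (simp add: window_def)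
qed

text \<open>
  A time without early return either starts a no-return window of \<open>x\<close> or has a threshold event among
  the next \<open>m\<close> steps. The second kind has density 0, because each threshold event accounts for at
  most \<open>m\<close> such times.
\<close>

lemma erw_range_upper_slope:
  assumes "m \<ge> 1"
    and walk: "upper_density_le {k. window m k x \<in> no_return_windows m} c"
    and excited: "upper_density_le {i. u (Suc i) \<le> p (Suc i)} 0"
    and "\<epsilon> > 0"
  shows "eventually (\<lambda>n. real (card (erw_path p x g u ` {0..n})) \<le> (c + \<epsilon>) * real n) sequentially"
proof -
  let ?X = "erw_path p x g u"
  let ?E = "{i. u (Suc i) \<le> p (Suc i)}"
  \<comment> \<open>Step \<open>i + 1\<close> leaves time \<open>i\<close>, so the window after \<open>k\<close> involves the indices \<open>k, \<dots>, k + m - 1\<close> of \<open>?E\<close>.\<close>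
  have sub: "{k. \<forall>j\<in>{1..m}. ?X (k + j) \<noteq> ?X k} \<subseteq>
      {k. window m k x \<in> no_return_windows m} \<union> {k. \<exists>j<m. k + j \<in> ?E}"
  proof
    fix k assume k: "k \<in> {k. \<forall>j\<in>{1..m}. ?X (k + j) \<noteq> ?X k}"
    show "k \<in> {k. window m k x \<in> no_return_windows m} \<union> {k. \<exists>j<m. k + j \<in> ?E}"
    proof (cases "\<exists>j<m. k + j \<in> ?E")
      case False
      then have "?X (k + j) = ?X k + (\<Sum>i\<in>{1..j}. x (k + i))" if "j \<in> {1..m}" for j
        using that by (intro erw_path_unexcited_window) (auto simp: not_le)
      then show ?thesis using k by (auto simp: window_in_no_return_windows_iff)
    qed auto
  qed
  have "upper_density_le ({k. window m k x \<in> no_return_windows m} \<union> {k. \<exists>j<m. k + j \<in> ?E}) (c + 0)"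
    by (intro upper_density_le_Un walk upper_density_le_zero_windows excited)
  from upper_density_le_mono[OF this sub]
  have "upper_density_le {k. \<forall>j\<in>{1..m}. ?X (k + j) \<noteq> ?X k} c" by simp
  from eventually_le_slope_of_bounded_excess[OF this card_range_le_no_return_times[OF assms(1)] \<open>\<epsilon> > 0\<close>]
  show ?thesis .
qed

section \<open>Densities of occurrence times of independent events\<close>

context prob_space
begin

text \<open>
  By Hoeffding's inequality the number of occurrences before \<open>n\<close> exceeds \<open>(c + \<epsilon>) n\<close> with probability at
  most \<open>exp (- 2 \<epsilon>\<^sup>2 n)\<close>. These bounds are summable, so almost surely this happens only finitely often.
\<close>

lemma indep_vars_occurrence_density:
  assumes indep: "indep_vars (\<lambda>_. N) W (UNIV :: nat set)" and D: "D \<in> sets N"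
    and c: "\<And>q. prob {\<omega> \<in> space M. W q \<omega> \<in> D} \<le> c"
  shows "AE \<omega> in M. upper_density_le {q. W q \<omega> \<in> D} c"
proof -
  let ?Z = "\<lambda>q \<omega>. indicator D (W q \<omega>) :: real"
  have W[measurable]: "W q \<in> M \<rightarrow>\<^sub>M N" for q
    using indep by (simp add: indep_vars_def)
  note D[measurable]
  have Z: "indep_vars (\<lambda>_. borel) ?Z UNIV"
    by (rule indep_vars_compose2[OF indep]) simp
  have count: "(\<Sum>q<n. ?Z q \<omega>) = real (card ({q. W q \<omega> \<in> D} \<inter> {..<n}))" for n \<omega>
  proof -
    have "(\<Sum>q<n. ?Z q \<omega>) = (\<Sum>q<n. real (indicator {q. W q \<omega> \<in> D} q))"
      by (intro sum.cong) (auto simp: indicator_def)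
    then show ?thesis
      by (simp only: sum_indicator_eq_card[OF finite_lessThan] Int_commute flip: of_nat_sum)
  qed
  have AE_eps: "AE \<omega> in M. eventually (\<lambda>n. (\<Sum>q<n. ?Z q \<omega>) \<le> (c + \<epsilon>) * real n) sequentially"
    if "\<epsilon> > 0" for \<epsilon> :: real
  proof -
    let ?B = "\<lambda>n. {\<omega> \<in> space M. (c + \<epsilon>) * real n < (\<Sum>q<n. ?Z q \<omega>)}"
    have tail: "prob (?B n) \<le> exp (- 2 * \<epsilon>\<^sup>2) ^ n" for n
    proof (cases "n = 0")
      case False
      interpret Hoeffding_ineq M "{..<n}" ?Z "\<lambda>_. 0" "\<lambda>_. 1" "\<Sum>q<n. expectation (?Z q)"
        by unfold_locales (use indep_vars_subset[OF Z] in \<open>auto simp: indicator_def\<close>)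
      have "expectation (?Z q) \<le> c" for q
      proof -
        have "expectation (?Z q) = expectation (indicator {\<omega> \<in> space M. W q \<omega> \<in> D})"
          by (intro Bochner_Integration.integral_cong) (auto simp: indicator_def)
        moreover have "{\<omega> \<in> space M. W q \<omega> \<in> D} \<inter> space M = {\<omega> \<in> space M. W q \<omega> \<in> D}"
          by auto
        ultimately show ?thesis using c[of q] by simp
      qed
      then have mean: "(\<Sum>q<n. expectation (?Z q)) \<le> c * real n"
        using sum_mono[of "{..<n}" "\<lambda>q. expectation (?Z q)" "\<lambda>_. c"] by (simp add: mult.commute)
      have "prob (?B n) \<le>
          prob {\<omega> \<in> space M. (\<Sum>q<n. ?Z q \<omega>) \<ge> (\<Sum>q<n. expectation (?Z q)) + \<epsilon> * real n}"
        using mean by (intro finite_measure_mono) (auto simp: algebra_simps)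
      also have "\<dots> \<le> exp (- 2 * (\<epsilon> * real n)\<^sup>2 / (\<Sum>q<n. (1 - 0)\<^sup>2))"
        using that False by (intro Hoeffding_ineq_ge) auto
      also have "\<dots> = exp (real n * (- 2 * \<epsilon>\<^sup>2))"
        using False by (simp add: power2_eq_square field_simps)
      also have "\<dots> = exp (- 2 * \<epsilon>\<^sup>2) ^ n"
        by (rule exp_of_nat_mult)
      finally show ?thesis .
    qed simp
    have geometric: "summable (\<lambda>n. exp (- 2 * \<epsilon>\<^sup>2) ^ n)"
      using that by (intro summable_geometric) simp
    have "AE \<omega> in M. eventually (\<lambda>n. \<omega> \<in> space M - ?B n) sequentially"
    proof (rule borel_cantelli_AE1)
      show "summable (\<lambda>n. prob (?B n))"
        by (rule summable_comparison_test'[OF geometric]) (use tail in simp)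
    qed (auto simp: less_top[symmetric])
    then show ?thesis
      by eventually_elim (erule eventually_mono, auto simp: not_less)
  qed
  \<comment> \<open>Only countably many \<open>\<epsilon>\<close> can share one null set.\<close>
  have "AE \<omega> in M. \<forall>j::nat. eventually (\<lambda>n. (\<Sum>q<n. ?Z q \<omega>) \<le> (c + 1 / Suc j) * real n) sequentially"
    by (subst AE_all_countable) (auto intro!: AE_eps)
  then show ?thesis
  proof eventually_elim
    case (elim \<omega>)
    show ?case
      unfolding upper_density_le_def
    proof (intro allI impI)
      fix \<epsilon> :: real assume "\<epsilon> > 0"
      then obtain j where j: "1 / real (Suc j) < \<epsilon>" by (rule nat_approx_posE)
      from elim have "eventually (\<lambda>n. (\<Sum>q<n. ?Z q \<omega>) \<le> (c + 1 / Suc j) * real n) sequentially" ..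
      then show "eventually (\<lambda>n. real (card ({q. W q \<omega> \<in> D} \<inter> {..<n})) \<le> (c + \<epsilon>) * real n) sequentially"
      proof eventually_elim
        case (elim n)
        have "(c + 1 / Suc j) * real n \<le> (c + \<epsilon>) * real n"
          using j by (intro mult_right_mono) auto
        with elim show ?case by (simp add: count)
      qed
    qed
  qed
qed

text \<open>
  Each \<open>X (f i)\<close> is a function of the block of \<open>X\<close> over the singleton \<open>{f i}\<close>, and blocks over disjoint
  index sets are independent.
\<close>

lemma indep_vars_reindex:
  assumes X: "indep_vars (\<lambda>_. N) X I" and f: "inj_on f L" "f ` L \<subseteq> I"
  shows "indep_vars (\<lambda>_. N) (\<lambda>i. X (f i)) L"
proof -
  have "disjoint_family_on (\<lambda>i. {f i}) L"
    using f(1) by (auto simp: disjoint_family_on_def inj_on_def)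
  then have "indep_vars (\<lambda>i. PiM {f i} (\<lambda>_. N)) (\<lambda>i \<omega>. restrict (\<lambda>j. X j \<omega>) {f i}) L"
    using f(2) by (intro indep_vars_restrict[OF X]) auto
  then have "indep_vars (\<lambda>_. N) (\<lambda>i \<omega>. restrict (\<lambda>j. X j \<omega>) {f i} (f i)) L"
    by (rule indep_vars_compose2[where Y = "\<lambda>i x. x (f i)"]) (rule measurable_component_singleton, simp)
  then show ?thesis by simp
qed

lemma iid_seqD:
  assumes "iid_seq N X"
  shows "indep_vars (\<lambda>_. N) X {1..}"
    and "i \<ge> 1 \<Longrightarrow> X i \<in> M \<rightarrow>\<^sub>M N"
    and "i \<ge> 1 \<Longrightarrow> distr M N (X i) = distr M N (X 1)"
  using assms unfolding iid_seq_def indep_vars_def by blast+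

lemma window_measurable:
  assumes "\<And>i. i \<ge> 1 \<Longrightarrow> X i \<in> M \<rightarrow>\<^sub>M N"
  shows "(\<lambda>\<omega>. window m k (\<lambda>i. X i \<omega>)) \<in> M \<rightarrow>\<^sub>M PiM {1..m} (\<lambda>_. N)"
  unfolding window_def using assms by (intro measurable_restrict) auto

text \<open>
  The window after \<open>r + q * m\<close> reads the indices in \<open>{r + q * m + 1..r + q * m + m}\<close>, and these blocks
  are disjoint for different \<open>q\<close>.
\<close>

lemma indep_vars_windows:
  assumes X: "indep_vars (\<lambda>_. N) X {1..}"
  shows "indep_vars (\<lambda>_. PiM {1..m} (\<lambda>_. N)) (\<lambda>q \<omega>. window m (r + q * m) (\<lambda>i. X i \<omega>)) (UNIV :: nat set)"
proof -
  let ?K = "\<lambda>q. {r + q * m + 1..r + q * m + m}"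
  let ?Y = "\<lambda>q \<omega>. restrict (\<lambda>i. X i \<omega>) (?K q)"
  have "disjoint_family_on ?K UNIV"
    unfolding disjoint_family_on_def
  proof (intro ballI impI)
    fix q q' :: nat assume "q \<noteq> q'"
    then have "q * m + m \<le> q' * m \<or> q' * m + m \<le> q * m"
      by (metis Suc_leI add.commute linorder_neqE_nat mult_Suc mult_le_mono1)
    then show "?K q \<inter> ?K q' = {}" by auto
  qed
  then have "indep_vars (\<lambda>q. PiM (?K q) (\<lambda>_. N)) ?Y UNIV"
    by (intro indep_vars_restrict[OF X]) auto
  then have "indep_vars (\<lambda>_. PiM {1..m} (\<lambda>_. N)) (\<lambda>q \<omega>. window m (r + q * m) (?Y q \<omega>)) UNIV"
    unfolding window_def
    by (rule indep_vars_compose2)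
      (intro measurable_restrict measurable_component_singleton, simp)
  moreover have "window m (r + q * m) (?Y q \<omega>) = window m (r + q * m) (\<lambda>i. X i \<omega>)" for q \<omega>
    by (auto simp: window_def)
  ultimately show ?thesis by simp
qed

lemma distr_window:
  assumes iid: "iid_seq N X" and "m \<ge> 1"
  shows "distr M (PiM {1..m} (\<lambda>_. N)) (\<lambda>\<omega>. window m k (\<lambda>i. X i \<omega>)) =
         PiM {1..m} (\<lambda>_. distr M N (X 1))"
proof -
  note indep = iid_seqD(1)[OF iid] and rv = iid_seqD(2)[OF iid] and same = iid_seqD(3)[OF iid]
  have "indep_vars (\<lambda>_. N) (\<lambda>i. X (k + i)) {1..m}"
    by (rule indep_vars_reindex[OF indep]) auto
  then have "distr M (PiM {1..m} (\<lambda>_. N)) (\<lambda>\<omega>. \<lambda>i\<in>{1..m}. X (k + i) \<omega>) =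
      PiM {1..m} (\<lambda>i. distr M N (X (k + i)))"
    using assms(2) rv by (subst (asm) indep_vars_iff_distr_eq_PiM') auto
  also have "\<dots> = PiM {1..m} (\<lambda>_. distr M N (X 1))"
    by (intro PiM_cong refl same) simp
  finally show ?thesis by (simp add: window_def)
qed

lemma window_occurrence_density:
  assumes iid: "iid_seq N X" and "m \<ge> 1" and D: "D \<in> sets (PiM {1..m} (\<lambda>_. N))"
  shows "AE \<omega> in M. upper_density_le {k. window m k (\<lambda>i. X i \<omega>) \<in> D}
           (prob {\<omega> \<in> space M. window m 0 (\<lambda>i. X i \<omega>) \<in> D})"
proof -
  note indep = iid_seqD(1)[OF iid] and meas = window_measurable[of X N, OF iid_seqD(2)[OF iid]]
  have prob_eq: "prob {\<omega> \<in> space M. window m k (\<lambda>i. X i \<omega>) \<in> D} =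
      measure (PiM {1..m} (\<lambda>_. distr M N (X 1))) D" for k
  proof -
    have "prob {\<omega> \<in> space M. window m k (\<lambda>i. X i \<omega>) \<in> D} =
        measure (distr M (PiM {1..m} (\<lambda>_. N)) (\<lambda>\<omega>. window m k (\<lambda>i. X i \<omega>))) D"
      using D by (subst measure_distr[OF meas]) (auto intro!: arg_cong[where f = prob])
    then show ?thesis by (simp only: distr_window[OF iid \<open>m \<ge> 1\<close>])
  qed
  have "AE \<omega> in M. \<forall>r::nat. upper_density_le {q. window m (r + q * m) (\<lambda>i. X i \<omega>) \<in> D}
           (prob {\<omega> \<in> space M. window m 0 (\<lambda>i. X i \<omega>) \<in> D})"
    unfolding AE_all_countable
    by (intro allI indep_vars_occurrence_density[OF indep_vars_windows[OF indep] D])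
      (simp only: prob_eq order_refl)
  then show ?thesis
  proof eventually_elim
    case (elim \<omega>)
    show ?case
      by (rule upper_density_le_residue_classes[OF \<open>m \<ge> 1\<close>]) (use elim in auto)
  qed
qed

text \<open>
  For each \<open>\<delta> > 0\<close>, all but finitely many thresholds are below \<open>\<delta>\<close>, so the set is contained in the
  occurrence times of \<open>U \<le> \<delta>\<close> up to a finite set. Those times have upper density at most \<open>\<delta>\<close>.
\<close>

lemma vanishing_threshold_density:
  assumes indep: "indep_vars (\<lambda>_. borel) U {1..}"
    and unif: "\<And>n. n \<ge> 1 \<Longrightarrow> distr M lborel (U n) = uniform_measure lborel {0..1}"
    and p: "p \<longlonglongrightarrow> (0 :: real)"
  shows "AE \<omega> in M. upper_density_le {i. U (Suc i) \<omega> \<le> p (Suc i)} 0"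
proof -
  have rv: "U i \<in> M \<rightarrow>\<^sub>M borel" if "i \<ge> 1" for i
    using indep that by (auto simp: indep_vars_def)
  have indep': "indep_vars (\<lambda>_. borel) (\<lambda>i. U (Suc i)) UNIV"
    by (rule indep_vars_reindex[OF indep]) auto
  have level: "prob {\<omega> \<in> space M. U (Suc i) \<omega> \<in> {..\<delta>}} \<le> \<delta>" if "\<delta> > 0" for i \<delta>
  proof -
    have "prob {\<omega> \<in> space M. U (Suc i) \<omega> \<in> {..\<delta>}} = measure (distr M lborel (U (Suc i))) {..\<delta>}"
      using rv[of "Suc i"] by (subst measure_distr) (auto intro!: arg_cong[where f = prob])
    also have "\<dots> = measure lborel ({0..1} \<inter> {..\<delta>})"
      by (subst unif) (auto simp: measure_uniform_measure)
    also have "\<dots> \<le> measure lborel {0..\<delta>}"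
      using that by (intro measure_mono_fmeasurable) (auto simp: fmeasurable_def)
    also have "\<dots> = \<delta>" using that by simp
    finally show ?thesis .
  qed
  have "AE \<omega> in M. \<forall>j::nat. upper_density_le {i. U (Suc i) \<omega> \<in> {..1 / Suc j}} (1 / Suc j)"
    unfolding AE_all_countable
    by (intro allI indep_vars_occurrence_density[OF indep'] level) auto
  then show ?thesis
  proof eventually_elim
    case (elim \<omega>)
    let ?E = "{i. U (Suc i) \<omega> \<le> p (Suc i)}"
    have dens: "upper_density_le ?E (1 / Suc j)" for j :: nat
    proof (rule upper_density_le_finite_excess)
      show "upper_density_le {i. U (Suc i) \<omega> \<in> {..1 / Suc j}} (1 / Suc j)" using elim ..
      have "eventually (\<lambda>i. p (Suc i) < 1 / Suc j) sequentially"
        using order_tendstoD(2)[OF LIMSEQ_Suc[OF p], of "1 / Suc j"] by simp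
      then obtain n where n: "\<And>i. i \<ge> n \<Longrightarrow> p (Suc i) < 1 / Suc j"
        unfolding eventually_sequentially by blast
      have "?E - {i. U (Suc i) \<omega> \<in> {..1 / Suc j}} \<subseteq> {..<n}"
      proof
        fix i assume "i \<in> ?E - {i. U (Suc i) \<omega> \<in> {..1 / Suc j}}"
        then show "i \<in> {..<n}" using n[of i] by (cases "i < n") auto
      qed
      then show "finite (?E - {i. U (Suc i) \<omega> \<in> {..1 / Suc j}})"
        using finite_subset by blast
    qed
    show ?case
      unfolding upper_density_le_def
    proof (intro allI impI)
      fix \<epsilon> :: real assume "\<epsilon> > 0"
      then obtain j where j: "1 / real (Suc j) < \<epsilon>" by (rule nat_approx_posE)
      then have "\<epsilon> - 1 / Suc j > 0" by simp
      with dens[of j]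
      have "eventually (\<lambda>n. real (card (?E \<inter> {..<n})) \<le> (1 / Suc j + (\<epsilon> - 1 / Suc j)) * real n) sequentially"
        unfolding upper_density_le_def by blast
      then show "eventually (\<lambda>n. real (card (?E \<inter> {..<n})) \<le> (0 + \<epsilon>) * real n) sequentially"
        by simp
    qed
  qed
qed

end

section \<open>The escape probability as a limit over window lengths\<close>

text \<open>
  The lattice carries the discrete sigma-algebra, in which addition is measurable because one
  summand can be fixed at each of its countably many values.
\<close>

lemma measurable_sum_countable:
  fixes f :: "'i \<Rightarrow> 'a \<Rightarrow> 'b :: {countable, comm_monoid_add}"
  assumes "\<And>i. i \<in> A \<Longrightarrow> f i \<in> M \<rightarrow>\<^sub>M count_space UNIV"
  shows "(\<lambda>x. \<Sum>i\<in>A. f i x) \<in> M \<rightarrow>\<^sub>M count_space UNIV"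
  using assms
proof (induction A rule: infinite_finite_induct)
  case (insert i A)
  have "(\<lambda>x. s + f i x) \<in> M \<rightarrow>\<^sub>M count_space UNIV" for s
    by (rule measurable_compose[OF insert.prems]) auto
  then have "(\<lambda>x. (\<Sum>i\<in>A. f i x) + f i x) \<in> M \<rightarrow>\<^sub>M count_space UNIV"
    by (rule measurable_compose_countable) (use insert in auto)
  then show ?case using insert.hyps by (simp add: add.commute)
qed auto

lemma no_return_windows_measurable:
  "(no_return_windows m :: (nat \<Rightarrow> 'b :: {countable, comm_monoid_add}) set)
     \<in> sets (PiM {1..m} (\<lambda>_. count_space UNIV))"
proof -
  let ?P = "PiM {1..m} (\<lambda>_. count_space UNIV) :: (nat \<Rightarrow> 'b) measure"
  have sum_meas: "(\<lambda>w. \<Sum>i\<in>{1..j}. w i) \<in> ?P \<rightarrow>\<^sub>M count_space UNIV" if "j \<in> {1..m}" for j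
    using that by (intro measurable_sum_countable measurable_component_singleton) auto
  have "{w \<in> space ?P. \<forall>j\<in>{1..m}. (\<Sum>i\<in>{1..j}. w i) \<noteq> 0} \<in> sets ?P"
  proof (intro sets.sets_Collect_finite_All)
    fix j assume j: "j \<in> {1..m}"
    have "{w \<in> space ?P. (\<Sum>i\<in>{1..j}. w i) \<noteq> 0} = (\<lambda>w. \<Sum>i\<in>{1..j}. w i) -` (- {0}) \<inter> space ?P"
      by auto
    also have "\<dots> \<in> sets ?P"
      by (rule measurable_sets[OF sum_meas[OF j]]) simp
    finally show "{w \<in> space ?P. (\<Sum>i\<in>{1..j}. w i) \<noteq> 0} \<in> sets ?P" .
  qed simp
  then show ?thesis
    by (simp add: no_return_windows_def space_PiM PiE_def)
qed

text \<open>
  The events of no return within \<open>m\<close> steps decrease in \<open>m\<close>, and their intersection is the event that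
  the walk never returns.
\<close>

lemma (in prob_space) no_return_prob_tendsto_escape_prob:
  assumes rv: "\<And>i. i \<ge> 1 \<Longrightarrow> \<xi> i \<in> M \<rightarrow>\<^sub>M count_space UNIV"
  shows "(\<lambda>m. prob {\<omega> \<in> space M. window m 0 (\<lambda>i. \<xi> i \<omega>) \<in> no_return_windows m})
           \<longlonglongrightarrow> escape_prob M \<xi>"
proof -
  let ?A = "\<lambda>m. {\<omega> \<in> space M. window m 0 (\<lambda>i. \<xi> i \<omega>) \<in> no_return_windows m}"
  have A: "?A m = {\<omega> \<in> space M. \<forall>j\<in>{1..m}. random_walk \<xi> j \<omega> \<noteq> 0}" for m
    by (simp add: window_in_no_return_windows_iff random_walk_def)
  have "?A m \<in> sets M" for m
    using measurable_sets[OF window_measurable[of \<xi>, OF rv] no_return_windows_measurable]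
    by (simp add: vimage_def Int_def conj_commute)
  then have "(\<lambda>m. prob (?A m)) \<longlonglongrightarrow> prob (\<Inter>m. ?A m)"
    by (intro finite_Lim_measure_decseq) (auto simp: A decseq_def)
  also have "(\<Inter>m. ?A m) = {\<omega> \<in> space M. \<forall>n\<ge>1. random_walk \<xi> n \<omega> \<noteq> 0}"
    unfolding A by force
  finally show ?thesis by (simp add: escape_prob_def)
qed

theorem proposition2p1:
  fixes M :: "'a measure" and F :: "nat \<Rightarrow> 'a measure"
    and l :: "real ^ 'd" and p :: "nat \<Rightarrow> real"
    and \<xi> \<gamma> :: "nat \<Rightarrow> 'a \<Rightarrow> int ^ 'd" and U :: "nat \<Rightarrow> 'a \<Rightarrow> real"
    and C \<beta> :: real
  assumes "CARD('d) \<ge> 2" and "C > 0" and "\<beta> > 0"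
    and "excited_random_walk M F l p \<xi> \<gamma> U"
    and "\<And>n. n \<ge> 1 \<Longrightarrow> p n = min (C * real n powr (- \<beta>)) 1"
  shows "AE \<omega> in M.
    limsup (\<lambda>n. ereal (real (card (walk_range (erw p \<xi> \<gamma> U) n \<omega>)) / real n))
      \<le> ereal (escape_prob M \<xi>)"
proof -
  interpret excited_random_walk M F l p \<xi> \<gamma> U by fact
  let ?A = "\<lambda>m. {\<omega> \<in> space M. window m 0 (\<lambda>i. \<xi> i \<omega>) \<in> no_return_windows m}"
  note rv = iid_seqD(2)[OF xi_iid]
  have "(\<lambda>n. min (C * real n powr (- \<beta>)) 1) \<longlonglongrightarrow> 0"
    using \<open>C > 0\<close> \<open>\<beta> > 0\<close> by real_asymp
  then have p: "p \<longlonglongrightarrow> 0"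
    by (rule Lim_transform_eventually)
      (use assms(5) in \<open>auto intro: eventually_mono[OF eventually_ge_at_top[of 1]]\<close>)
  have "AE \<omega> in M. \<forall>m::nat. m \<ge> 1 \<longrightarrow>
      upper_density_le {k. window m k (\<lambda>i. \<xi> i \<omega>) \<in> no_return_windows m} (prob (?A m))"
    unfolding AE_all_countable
    by (auto intro!: window_occurrence_density[OF xi_iid] no_return_windows_measurable)
  moreover have "AE \<omega> in M. upper_density_le {i. U (Suc i) \<omega> \<le> p (Suc i)} 0"
    by (rule vanishing_threshold_density[OF iid_seqD(1)[OF U_iid] U_uniform p])
  ultimately show ?thesis
  proof eventually_elim
    case (elim \<omega>)
    let ?R = "\<lambda>n. real (card (walk_range (erw p \<xi> \<gamma> U) n \<omega>))"
    have R: "walk_range (erw p \<xi> \<gamma> U) n \<omega> =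
        erw_path p (\<lambda>i. \<xi> i \<omega>) (\<lambda>i. \<gamma> i \<omega>) (\<lambda>i. U i \<omega>) ` {0..n}" for n
      by (simp add: walk_range_def erw_def)
    have bound: "limsup (\<lambda>n. ereal (?R n / real n)) \<le> ereal (escape_prob M \<xi>) + ereal \<epsilon>"
      if "\<epsilon> > 0" for \<epsilon> :: real
    proof -
      have "eventually (\<lambda>m. prob (?A m) < escape_prob M \<xi> + \<epsilon> / 2) sequentially"
        using that
        by (intro order_tendstoD(2)[OF no_return_prob_tendsto_escape_prob[of \<xi>, OF rv]]) auto
      then have "eventually (\<lambda>m. m \<ge> 1 \<and> prob (?A m) < escape_prob M \<xi> + \<epsilon> / 2) sequentially"
        using eventually_ge_at_top[of 1] by eventually_elim auto
      then obtain m where m: "m \<ge> 1" "prob (?A m) < escape_prob M \<xi> + \<epsilon> / 2"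
        unfolding eventually_sequentially by blast
      have "eventually (\<lambda>n. ?R n \<le> (prob (?A m) + \<epsilon> / 2) * real n) sequentially"
        unfolding R using m(1) elim that by (intro erw_range_upper_slope[of m]) auto
      moreover have "eventually (\<lambda>n::nat. n \<ge> 1) sequentially"
        by (rule eventually_ge_at_top)
      ultimately have "eventually (\<lambda>n. ereal (?R n / real n) \<le> ereal (escape_prob M \<xi> + \<epsilon>)) sequentially"
      proof eventually_elim
        case (elim n)
        have "?R n / real n \<le> prob (?A m) + \<epsilon> / 2"
          using elim by (simp add: divide_le_eq)
        then show ?case using m(2) by simp
      qed
      then have "limsup (\<lambda>n. ereal (?R n / real n)) \<le> ereal (escape_prob M \<xi> + \<epsilon>)"
        by (rule Limsup_bounded)
      then show ?thesis by simp
    qed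
    show ?case
      by (rule ereal_le_epsilon2) (rule bound)
  qed
qed

end
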